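(* Let $\alpha>0$ and let $a,b>0$ be real numbers. Then the area $\mathcal{A}$ enclosed by the superellipse $\left|\frac{x}{a}\right|^{\alpha}+\left|\frac{y}{b}\right|^{\alpha}=1$ in the plane is $$\mathcal{A}=2^{1-\frac{2}{\alpha}}\,\varpi_{\alpha}\,ab,$$ where $\varpi_{\alpha}=2\int_0^1\frac{dr}{\sqrt{1-r^{\alpha}}}$, and $\varpi_\alpha$ is the arc length of the principal leaf of the sinusoidal spiral $r^{\frac{\alpha}{2}}=\cos\left(\frac{\alpha}{2}\,\theta\right)$ within the polar sector $-\frac{\pi}{\alpha}\le\theta\le\frac{\pi}{\alpha}$.
   Context: The enclosed area is the area of the region $\left\{(x,y)\in\mathbb{R}^2 : \left|\frac{x}{a}\right|^{\alpha}+\left|\frac{y}{b}\right|^{\alpha}\le 1\right\}$. The principal leaf of the sinusoidal spiral is the polar curve $\theta\mapsto (r\cos\theta, r\sin\theta)$ with $r=\left(\cos\left(\frac{\alpha}{2}\theta\right)\right)^{2/\alpha}\ge 0$ for $-\frac{\pi}{\alpha}\le\theta\le\frac{\pi}{\alpha}$; its arc length is the length of this parametrized curve. *)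

theory Defs
  imports "HOL-Analysis.Analysis"
begin

definition superellipse_region :: "real \<Rightarrow> real \<Rightarrow> real \<Rightarrow> (real \<times> real) set" where
  "superellipse_region \<alpha> a b = {(x, y). \<bar>x / a\<bar> powr \<alpha> + \<bar>y / b\<bar> powr \<alpha> \<le> 1}"

text \<open>
  The integrand is unbounded near \<open>r = 1\<close>, where Isabelle's conventions give it the value \<open>0\<close>.
  For \<open>\<alpha> > 0\<close> the improper Riemann integral exists and agrees with the Henstock--Kurzweil
  integral over the closed interval.
\<close>
definition varpi :: "real \<Rightarrow> real" where
  "varpi \<alpha> = 2 * integral {0..1} (\<lambda>r. 1 / sqrt (1 - r powr \<alpha>))"

text \<open>
  The length of the curve \<open>\<gamma>\<close> restricted to \<open>{s..t}\<close>, counted with multiplicity: the supremum of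
  the lengths of inscribed polygons over all partitions \<open>s = u 0 \<le> \<dots> \<le> u n = t\<close>. It is
  \<open>\<infinity>\<close> for a curve that is not rectifiable.
\<close>
definition curve_length :: "(real \<Rightarrow> 'a::metric_space) \<Rightarrow> real \<Rightarrow> real \<Rightarrow> ennreal" where
  "curve_length \<gamma> s t =
     (SUP (n, u) \<in> {(n::nat, u::nat \<Rightarrow> real). mono_on {..n} u \<and> u 0 = s \<and> u n = t}.
        ennreal (\<Sum>i<n. dist (\<gamma> (u i)) (\<gamma> (u (Suc i)))))"

definition spiral_radius :: "real \<Rightarrow> real \<Rightarrow> real" where
  "spiral_radius \<alpha> \<theta> = cos (\<alpha> / 2 * \<theta>) powr (2 / \<alpha>)"

text \<open>
  Only the parameters \<open>\<theta> \<in> {- pi / \<alpha>..pi / \<alpha>}\<close> belong to the principal leaf; there the cosine is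
  nonnegative and \<open>spiral_radius \<alpha> \<theta>\<close> is the unique \<open>r \<ge> 0\<close> with
  \<open>r powr (\<alpha> / 2) = cos (\<alpha> / 2 * \<theta>)\<close>.
\<close>
definition sinusoidal_spiral :: "real \<Rightarrow> real \<Rightarrow> real \<times> real" where
  "sinusoidal_spiral \<alpha> \<theta> = (spiral_radius \<alpha> \<theta> * cos \<theta>, spiral_radius \<alpha> \<theta> * sin \<theta>)"

end

theory Submission
  imports Defs
begin

text \<open>
  Both quantities reduce to one integral. Put \<open>p = 1 / \<alpha>\<close>. The substitution \<open>r = t powr p\<close> turns
  the integral defining \<open>varpi \<alpha>\<close> into the Beta integral \<open>p * Beta p (1/2)\<close>.

  The area: the vertical section of the superellipse at \<open>x\<close> is an interval of length
  \<open>2 * b * (1 - \<bar>x / a\<bar> powr \<alpha>) powr p\<close>. Integrating this length over \<open>{- a..a}\<close> and substituting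
  \<open>x = a * t powr p\<close> gives \<open>4 * a * b * p * Beta p (p + 1)\<close>. The Legendre duplication formula
  converts \<open>Beta p (p + 1)\<close> into \<open>Beta p (1/2)\<close>, and the powers of two in it are the factor
  \<open>2 powr (1 - 2 / \<alpha>)\<close>. This is \<open>measure_superellipse_region\<close>.

  The arc length: differentiating the spiral gives a velocity of norm
  \<open>cos (\<alpha> / 2 * \<theta>) powr (2 / \<alpha> - 1)\<close>. With the radius \<open>r\<close> as new variable on the half
  \<open>0 < \<theta> < pi / \<alpha>\<close> of the leaf, \<open>\<bar>dr / d\<theta>\<bar>\<close> is that norm times
  \<open>sin (\<alpha> / 2 * \<theta>) = sqrt (1 - r powr \<alpha>)\<close>, so the integral of the speed over this half is
  \<open>varpi \<alpha> / 2\<close>.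

  What remains is that the supremum over inscribed polygons equals the integral of the speed. At the
  ends of the leaf the speed blows up for \<open>\<alpha> > 2\<close>, so a theorem for curves that are \<open>C\<^sup>1\<close> on
  the closed interval does not apply. \<open>curve_length_eq_integral_norm_derivative\<close> asks only for
  continuity on the closed interval, a continuous derivative inside, and an integrable speed.
\<close>

section \<open>Substitution in improper integrals\<close>

text \<open>
  For a nonnegative integrand integrability and absolute integrability coincide, so the change of
  variables theorem for absolutely integrable functions becomes an equivalence for \<open>has_integral\<close>.
  It is used on open intervals, for integrands that are unbounded at the ends.
\<close>

lemma has_integral_nonneg_substitution_iff:
  fixes f g g' :: "real \<Rightarrow> real"
  assumes S: "S \<in> sets lebesgue"
    and der: "\<And>x. x \<in> S \<Longrightarrow> (g has_field_derivative g' x) (at x)"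
    and inj: "inj_on g S"
    and nonneg: "\<And>y. y \<in> g ` S \<Longrightarrow> 0 \<le> f y"
  shows "((\<lambda>x. \<bar>g' x\<bar> * f (g x)) has_integral I) S \<longleftrightarrow> (f has_integral I) (g ` S)"
proof -
  have "(h has_integral I) T \<longleftrightarrow> h absolutely_integrable_on T \<and> integral T h = I"
    if "\<And>x. x \<in> T \<Longrightarrow> 0 \<le> h x" for h :: "real \<Rightarrow> real" and T
    using that nonnegative_absolutely_integrable_1[of h T] set_lebesgue_integral_eq_integral(1)[of T h]
    by (auto simp: has_integral_iff)
  moreover have "0 \<le> \<bar>g' x\<bar> * f (g x)" if "x \<in> S" for x
    using nonneg that by auto
  ultimately show ?thesis
    using has_absolute_integral_change_of_variables_1'[OF S has_field_derivative_at_within[OF der] inj, of f I]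
      nonneg by simp
qed

lemma has_integral_even:
  fixes f :: "real \<Rightarrow> real"
  assumes "(f has_integral I) {0..a}" and "0 \<le> a" and even: "\<And>x. f (- x) = f x"
  shows "(f has_integral 2 * I) {- a..a}"
proof -
  have "((\<lambda>x. f (- x)) has_integral I) {- a..- 0}"
    using assms(1) by (subst has_integral_reflect_real)
  then have "(f has_integral I) {- a..0}"
    by (simp add: even)
  from has_integral_combine[OF _ _ this assms(1)] show ?thesis
    using assms(2) by simp
qed

section \<open>A duplication formula for the Beta function\<close>

lemma Gamma_legendre_duplication_real:
  fixes p :: real
  assumes "p > 0"
  shows "Gamma p * Gamma (p + 1/2) = 2 powr (1 - 2 * p) * sqrt pi * Gamma (2 * p)"
proof -
  have "complex_of_real (Gamma p * Gamma (p + 1/2))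
      = Gamma (complex_of_real p) * Gamma (complex_of_real p + 1/2)"
    using Gamma_complex_of_real[of "p + 1/2"] by (simp add: Gamma_complex_of_real)
  also have "\<dots> = exp ((1 - 2 * complex_of_real p) * of_real (ln 2)) * of_real (sqrt pi)
      * Gamma (2 * complex_of_real p)"
  proof (rule Gamma_legendre_duplication)
    show "complex_of_real p \<notin> \<int>\<^sub>\<le>\<^sub>0"
      using assms by (auto elim!: nonpos_Ints_cases simp: complex_eq_iff)
    show "complex_of_real p + 1/2 \<notin> \<int>\<^sub>\<le>\<^sub>0"
      using assms by (auto elim!: nonpos_Ints_cases simp: complex_eq_iff)
  qed
  also have "\<dots> = complex_of_real (exp ((1 - 2 * p) * ln 2) * sqrt pi * Gamma (2 * p))"
    using Gamma_complex_of_real[of "2 * p"] by (simp flip: exp_of_real)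
  finally show ?thesis
    unfolding of_real_eq_iff by (simp add: powr_def)
qed

text \<open>
  The factor \<open>Gamma (p + 1) / Gamma (2 * p + 1)\<close> is \<open>Gamma p / (2 * Gamma (2 * p))\<close>, so
  \<open>Beta p (p + 1)\<close> is half of \<open>Beta p p\<close>; the duplication formula then removes \<open>Gamma (2 * p)\<close>.
\<close>

lemma Beta_self_Suc:
  fixes p :: real
  assumes "p > 0"
  shows "Beta p (p + 1) = 2 powr (1 - 2 * p) * Beta p (1/2) / 2"
proof -
  have pos: "Gamma p > 0" "Gamma (p + 1/2) > 0" "Gamma (2 * p) > 0"
    using assms by (auto intro!: Gamma_real_pos)
  have "Gamma (p + 1) = p * Gamma p" and "Gamma (2 * p + 1) = 2 * p * Gamma (2 * p)"
    using assms by (auto intro!: Gamma_plus1 elim!: nonpos_Ints_cases)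
  then have "Beta p (p + 1) = Gamma p * Gamma p / (2 * Gamma (2 * p))"
    using assms pos by (simp add: Beta_def mult_2[symmetric] add.assoc[symmetric])
  also have "\<dots> = 2 powr (1 - 2 * p) * Beta p (1/2) / 2"
    using Gamma_legendre_duplication_real[OF assms] pos
    by (simp add: Beta_def Gamma_one_half_real field_simps)
  finally show ?thesis .
qed

section \<open>The integral that defines varpi\<close>

lemma powr_le_powr_iff_base:
  fixes u v p :: real
  assumes "p > 0" and "0 \<le> u" and "0 \<le> v"
  shows "u powr p \<le> v powr p \<longleftrightarrow> u \<le> v"
  using assms powr_mono2[of p u v] powr_less_mono2[of p v u] by (cases "u \<le> v") auto

lemma inj_on_powr_base:
  fixes p :: real
  assumes "p > 0"
  shows "inj_on (\<lambda>u. u powr p) {0..}"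
proof (rule inj_onI)
  fix u v :: real
  assume "u \<in> {0..}" "v \<in> {0..}" "u powr p = v powr p"
  then show "u = v"
    using powr_le_powr_iff_base[OF assms, of u v] powr_le_powr_iff_base[OF assms, of v u] by auto
qed

lemma mult_image_greaterThanLessThan:
  fixes c d :: real
  assumes "c > 0"
  shows "(\<lambda>x. c * x) ` {0<..<d} = {0<..<c * d}"
proof (intro equalityI subsetI)
  fix y
  assume "y \<in> {0<..<c * d}"
  then show "y \<in> (\<lambda>x. c * x) ` {0<..<d}"
    using assms by (intro image_eqI[of _ _ "y / c"]) (auto simp: field_simps)
qed (use assms in auto)

lemma powr_image_unit_interval:
  fixes p :: real
  assumes "p > 0"
  shows "(\<lambda>t. t powr p) ` {0<..<1} = {0<..<1}"
proof (intro equalityI subsetI)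
  fix r :: real
  assume "r \<in> {0<..<1}"
  then show "r \<in> (\<lambda>t. t powr p) ` {0<..<1}"
    using assms powr_less_mono2[of "1/p" r 1] by (intro image_eqI[of _ _ "r powr (1 / p)"]) (auto simp: powr_powr)
qed (use assms powr_less_mono2[of p _ 1] in auto)

text \<open>
  The substitution \<open>r = c * t powr p\<close>, in the direction in which Beta integrals are evaluated: the
  known integral over \<open>t\<close> yields the one over \<open>r\<close>. The endpoints, where \<open>t powr p\<close> need not be
  differentiable, form a null set.
\<close>

lemma has_integral_powr_substitution:
  fixes f :: "real \<Rightarrow> real"
  assumes "p > 0" and "c > 0" and "\<And>r. r \<in> {0<..<c} \<Longrightarrow> 0 \<le> f r"
    and int: "((\<lambda>t. c * p * t powr (p - 1) * f (c * t powr p)) has_integral I) {0..1}"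
  shows "(f has_integral I) {0..c}"
proof -
  have img: "(\<lambda>t. c * t powr p) ` {0<..<1} = {0<..<c}"
    using image_image[of "\<lambda>x. c * x" "\<lambda>t. t powr p" "{0<..<1}"]
    by (simp add: powr_image_unit_interval mult_image_greaterThanLessThan assms)
  have "((\<lambda>t. \<bar>c * (p * t powr (p - 1))\<bar> * f (c * t powr p)) has_integral I) {0<..<1}"
    using int unfolding has_integral_Icc_iff_Ioo
    by (rule has_integral_eq[rotated]) (use assms in \<open>simp add: abs_mult\<close>)
  moreover have "((\<lambda>t. \<bar>c * (p * t powr (p - 1))\<bar> * f (c * t powr p)) has_integral I) {0<..<1}
      \<longleftrightarrow> (f has_integral I) ((\<lambda>t. c * t powr p) ` {0<..<1})"
  proof (rule has_integral_nonneg_substitution_iff)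
    show "((\<lambda>t. c * t powr p) has_field_derivative c * (p * x powr (p - 1))) (at x)"
      if "x \<in> {0<..<1}" for x
      using that by (auto intro!: derivative_eq_intros)
    have "inj_on (\<lambda>t. t powr p) {0<..<1}"
      by (rule inj_on_subset[OF inj_on_powr_base[OF \<open>p > 0\<close>]]) auto
    then show "inj_on (\<lambda>t. c * t powr p) {0<..<1}"
      using \<open>c > 0\<close> by (simp add: inj_on_def)
  qed (use assms img in auto)
  ultimately show ?thesis
    by (simp add: img has_integral_Icc_iff_Ioo)
qed

lemma has_integral_varpi_Beta:
  assumes "\<alpha> > 0"
  shows "((\<lambda>r. 1 / sqrt (1 - r powr \<alpha>)) has_integral Beta (1 / \<alpha>) (1 / 2) / \<alpha>) {0..1}"
proof (rule has_integral_powr_substitution)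
  have "((\<lambda>t. t powr (1 / \<alpha> - 1) * (1 - t) powr (1/2 - 1) / \<alpha>) has_integral
      Beta (1 / \<alpha>) (1 / 2) / \<alpha>) {0..1}"
    by (intro has_integral_divide has_integral_Beta_real) (use assms in auto)
  then show "((\<lambda>t. 1 * (1 / \<alpha>) * t powr (1 / \<alpha> - 1) * (1 / sqrt (1 - (1 * t powr (1 / \<alpha>)) powr \<alpha>)))
      has_integral Beta (1 / \<alpha>) (1 / 2) / \<alpha>) {0..1}"
    by (rule has_integral_eq[rotated])
      (use assms in \<open>auto simp: powr_powr powr_minus powr_half_sqrt[symmetric] field_simps\<close>)
  show "0 \<le> 1 / sqrt (1 - r powr \<alpha>)" if "r \<in> {0<..<1}" for r :: real
    using that assms powr_less_mono2[of \<alpha> r 1] by auto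
qed (use assms in auto)

text \<open>
  Since \<open>varpi\<close> is defined by \<open>integral\<close>, which has a default value for functions that are not
  integrable, this records that the integral exists.
\<close>

lemma has_integral_varpi:
  assumes "\<alpha> > 0"
  shows "((\<lambda>r. 1 / sqrt (1 - r powr \<alpha>)) has_integral varpi \<alpha> / 2) {0..1}"
  using has_integral_varpi_Beta[OF assms] by (simp add: varpi_def has_integral_iff)

lemma varpi_eq_Beta:
  assumes "\<alpha> > 0"
  shows "varpi \<alpha> = 2 / \<alpha> * Beta (1 / \<alpha>) (1 / 2)"
  using has_integral_varpi_Beta[OF assms] by (simp add: varpi_def has_integral_iff)

section \<open>The area of the superellipse\<close>

lemma superellipse_region_section:
  assumes "\<alpha> > 0" and "a > 0" and "b > 0"
  shows "Pair x -` superellipse_region \<alpha> a b =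
    (if x \<in> {- a..a} then {- (b * (1 - \<bar>x / a\<bar> powr \<alpha>) powr (1 / \<alpha>))..b * (1 - \<bar>x / a\<bar> powr \<alpha>) powr (1 / \<alpha>)}
     else {})"
proof -
  have "0 \<le> 1 - \<bar>x / a\<bar> powr \<alpha> \<longleftrightarrow> \<bar>x / a\<bar> \<le> 1"
    using powr_le_powr_iff_base[OF assms(1), of "\<bar>x / a\<bar>" 1] by simp
  also have "\<dots> \<longleftrightarrow> x \<in> {- a..a}"
    using assms by (auto simp: abs_divide)
  finally have in_iff: "x \<in> {- a..a} \<longleftrightarrow> 0 \<le> 1 - \<bar>x / a\<bar> powr \<alpha>" ..
  have pos: "\<bar>y / b\<bar> powr \<alpha> \<le> c \<longleftrightarrow> y \<in> {- (b * c powr (1 / \<alpha>))..b * c powr (1 / \<alpha>)}" if "0 \<le> c" for c y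
  proof -
    have "\<bar>y / b\<bar> powr \<alpha> \<le> c \<longleftrightarrow> \<bar>y / b\<bar> \<le> c powr (1 / \<alpha>)"
      using that assms powr_le_powr_iff_base[of \<alpha> "\<bar>y / b\<bar>" "c powr (1 / \<alpha>)"] by (simp add: powr_powr)
    also have "\<dots> \<longleftrightarrow> \<bar>y\<bar> \<le> b * c powr (1 / \<alpha>)"
      using assms by (simp add: pos_divide_le_eq mult.commute)
    finally show ?thesis
      by (auto simp: abs_le_iff)
  qed
  have neg: "\<not> \<bar>y / b\<bar> powr \<alpha> \<le> c" if "\<not> 0 \<le> c" for c y
    using that powr_ge_zero[of "\<bar>y / b\<bar>" \<alpha>] by linarith
  have "Pair x -` superellipse_region \<alpha> a b = {y. \<bar>y / b\<bar> powr \<alpha> \<le> 1 - \<bar>x / a\<bar> powr \<alpha>}"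
    by (auto simp: superellipse_region_def)
  then show ?thesis
    unfolding in_iff using pos[of "1 - \<bar>x / a\<bar> powr \<alpha>"] neg[of "1 - \<bar>x / a\<bar> powr \<alpha>"]
    by (cases "0 \<le> 1 - \<bar>x / a\<bar> powr \<alpha>") (simp_all only: if_True if_False Collect_mem_eq not_False_eq_True empty_def[symmetric] simp_thms)
qed

lemma superellipse_height_has_integral:
  fixes \<alpha> a b :: real
  assumes "\<alpha> > 0" and "a > 0" and "b > 0"
  shows "((\<lambda>x. 2 * (b * (1 - \<bar>x / a\<bar> powr \<alpha>) powr (1 / \<alpha>))) has_integral
      4 * a * b / \<alpha> * Beta (1 / \<alpha>) (1 / \<alpha> + 1)) {- a..a}"
proof -
  have "((\<lambda>t. 2 * a * b / \<alpha> * (t powr (1 / \<alpha> - 1) * (1 - t) powr (1 / \<alpha> + 1 - 1))) has_integral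
      2 * a * b / \<alpha> * Beta (1 / \<alpha>) (1 / \<alpha> + 1)) {0..1}"
    by (rule has_integral_mult_right[OF has_integral_Beta_real]) (use assms in \<open>auto intro: add_pos_pos\<close>)
  then have "((\<lambda>t. a * (1 / \<alpha>) * t powr (1 / \<alpha> - 1) *
        (2 * (b * (1 - \<bar>a * t powr (1 / \<alpha>) / a\<bar> powr \<alpha>) powr (1 / \<alpha>)))) has_integral
      2 * a * b / \<alpha> * Beta (1 / \<alpha>) (1 / \<alpha> + 1)) {0..1}"
    by (rule has_integral_eq[rotated]) (use assms in \<open>auto simp: powr_powr\<close>)
  then have "((\<lambda>x. 2 * (b * (1 - \<bar>x / a\<bar> powr \<alpha>) powr (1 / \<alpha>))) has_integral
      2 * a * b / \<alpha> * Beta (1 / \<alpha>) (1 / \<alpha> + 1)) {0..a}"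
    by (rule has_integral_powr_substitution[rotated 3]) (use assms in auto)
  from has_integral_even[OF this] show ?thesis
    using assms by (simp add: mult.assoc)
qed

lemma measure_superellipse_region:
  assumes "\<alpha> > 0" and "a > 0" and "b > 0"
  shows "measure lebesgue (superellipse_region \<alpha> a b) = 2 powr (1 - 2 / \<alpha>) * varpi \<alpha> * a * b"
proof -
  let ?h = "\<lambda>x. b * (1 - \<bar>x / a\<bar> powr \<alpha>) powr (1 / \<alpha>)"
  let ?I = "4 * a * b / \<alpha> * Beta (1 / \<alpha>) (1 / \<alpha> + 1)"
  have "Measurable.pred (borel \<Otimes>\<^sub>M borel) (\<lambda>(x, y). \<bar>x / a\<bar> powr \<alpha> + \<bar>y / b\<bar> powr \<alpha> \<le> (1::real))"
    by measurable
  then have meas: "superellipse_region \<alpha> a b \<in> sets (borel \<Otimes>\<^sub>M borel)"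
    by (simp add: pred_def superellipse_region_def space_pair_measure)
  have "emeasure lborel (superellipse_region \<alpha> a b)
      = (\<integral>\<^sup>+x. emeasure lborel (Pair x -` superellipse_region \<alpha> a b) \<partial>lborel)"
    using meas by (subst lborel_prod[symmetric], intro lborel.emeasure_pair_measure_alt) simp
  also have "\<dots> = (\<integral>\<^sup>+x. ennreal (2 * ?h x) * indicator {- a..a} x \<partial>lborel)"
    using assms by (intro nn_integral_cong) (auto simp: superellipse_region_section indicator_def)
  also have "\<dots> = ennreal ?I"
    by (rule nn_integral_has_integral_lebesgue'[OF _ superellipse_height_has_integral]) (use assms in auto)
  finally have em: "emeasure lborel (superellipse_region \<alpha> a b) = ennreal ?I" .
  have "0 \<le> ?I"
    using has_integral_nonneg[OF superellipse_height_has_integral[OF assms]] assms by simp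
  then have "measure lborel (superellipse_region \<alpha> a b) = ?I"
    using em by (simp add: measure_def)
  moreover have "superellipse_region \<alpha> a b \<in> sets lborel"
    using meas unfolding borel_prod by simp
  ultimately have "measure lebesgue (superellipse_region \<alpha> a b) = ?I"
    by simp
  also have "\<dots> = 2 powr (1 - 2 / \<alpha>) * varpi \<alpha> * a * b"
    using assms Beta_self_Suc[of "1 / \<alpha>"] by (simp add: varpi_eq_Beta field_simps)
  finally show ?thesis .
qed

section \<open>Arc length as the integral of the speed\<close>

text \<open>
  A polygon inscribed in \<open>{c..d}\<close> becomes one inscribed in \<open>{s..t}\<close> when \<open>s\<close> and \<open>t\<close> are
  added as first and last partition points; this shifts all indices by one.
\<close>

lemma curve_length_mono:
  fixes \<gamma> :: "real \<Rightarrow> 'a::metric_space"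
  assumes "s \<le> c" and "c \<le> d" and "d \<le> t"
  shows "curve_length \<gamma> c d \<le> curve_length \<gamma> s t"
  unfolding curve_length_def
proof (rule SUP_mono, clarsimp)
  fix n :: nat and u :: "nat \<Rightarrow> real"
  assume u: "mono_on {..n} u" "c = u 0" "d = u n"
  define w where "w i = (if i = 0 then s else if i \<le> Suc n then u (i - 1) else t)" for i
  have "mono_on {..Suc (Suc n)} w"
  proof (rule mono_onI)
    fix i j
    assume ij: "i \<in> {..Suc (Suc n)}" "j \<in> {..Suc (Suc n)}" "i \<le> j"
    have bnd: "s \<le> u k" "u k \<le> t" if "k \<le> n" for k
      using that u assms mono_onD[OF u(1), of 0 k] mono_onD[OF u(1), of k n] by auto
    show "w i \<le> w j"
      using ij bnd assms mono_onD[OF u(1), of "i - 1" "j - 1"] unfolding w_def by auto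
  qed
  moreover have "(\<Sum>i<n. dist (\<gamma> (u i)) (\<gamma> (u (Suc i))))
      \<le> (\<Sum>i<Suc (Suc n). dist (\<gamma> (w i)) (\<gamma> (w (Suc i))))"
  proof -
    have "(\<Sum>i<n. dist (\<gamma> (u i)) (\<gamma> (u (Suc i)))) = (\<Sum>i<n. dist (\<gamma> (w (Suc i))) (\<gamma> (w (Suc (Suc i)))))"
      by (rule sum.cong) (auto simp: w_def)
    also have "\<dots> \<le> (\<Sum>i<Suc n. dist (\<gamma> (w i)) (\<gamma> (w (Suc i))))"
      by (subst sum.lessThan_Suc_shift) simp
    also have "\<dots> \<le> (\<Sum>i<Suc (Suc n). dist (\<gamma> (w i)) (\<gamma> (w (Suc i))))"
      by (subst (2) sum.lessThan_Suc) simp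
    finally show ?thesis .
  qed
  ultimately show "\<exists>m v. mono_on {..m} v \<and> v 0 = s \<and> v m = t \<and>
      ennreal (\<Sum>i<n. dist (\<gamma> (u i)) (\<gamma> (u (Suc i)))) \<le> ennreal (\<Sum>i<m. dist (\<gamma> (v i)) (\<gamma> (v (Suc i))))"
    by (intro exI[of _ "Suc (Suc n)"] exI[of _ w]) (auto simp: w_def intro: ennreal_leI)
qed

text \<open>
  This and the next lemma compare length with the increment of a function \<open>F\<close>, which stands for the
  arc length measured from the initial point. A bound for every chord sums up by telescoping.
\<close>

lemma curve_length_le_of_dist_le:
  fixes \<gamma> :: "real \<Rightarrow> 'a::metric_space"
  assumes le: "\<And>p q. s \<le> p \<Longrightarrow> p \<le> q \<Longrightarrow> q \<le> t \<Longrightarrow> dist (\<gamma> p) (\<gamma> q) \<le> F q - F p"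
  shows "curve_length \<gamma> s t \<le> ennreal (F t - F s)"
  unfolding curve_length_def
proof (rule SUP_least, clarsimp)
  fix n :: nat and u :: "nat \<Rightarrow> real"
  assume u: "mono_on {..n} u" "s = u 0" "t = u n"
  have "(\<Sum>i<n. dist (\<gamma> (u i)) (\<gamma> (u (Suc i)))) \<le> (\<Sum>i<n. F (u (Suc i)) - F (u i))"
  proof (rule sum_mono)
    fix i assume "i \<in> {..<n}"
    then show "dist (\<gamma> (u i)) (\<gamma> (u (Suc i))) \<le> F (u (Suc i)) - F (u i)"
      using u mono_onD[OF u(1), of 0 i] mono_onD[OF u(1), of i "Suc i"] mono_onD[OF u(1), of "Suc i" n]
      by (intro le) auto
  qed
  also have "\<dots> = F (u n) - F (u 0)"
    by (rule sum_lessThan_telescope)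
  finally show "ennreal (\<Sum>i<n. dist (\<gamma> (u i)) (\<gamma> (u (Suc i)))) \<le> ennreal (F (u n) - F (u 0))"
    by (rule ennreal_leI)
qed

text \<open>
  For the lower bound, short chords may fall short of the increment of \<open>F\<close> by a small proportion of
  the parameter step, since these errors add up to at most \<open>\<epsilon> * (d - c)\<close> over a whole partition.
\<close>

lemma curve_length_ge_of_dist_ge:
  fixes \<gamma> :: "real \<Rightarrow> 'a::metric_space"
  assumes "c \<le> d"
    and ge: "\<And>\<epsilon>. \<epsilon> > 0 \<Longrightarrow> \<exists>\<delta>>0. \<forall>p q. c \<le> p \<longrightarrow> p \<le> q \<longrightarrow> q \<le> d \<longrightarrow> q - p < \<delta> \<longrightarrow>
      F q - F p \<le> dist (\<gamma> p) (\<gamma> q) + \<epsilon> * (q - p)"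
  shows "ennreal (F d - F c) \<le> curve_length \<gamma> c d"
proof (rule ennreal_le_epsilon)
  fix e :: real
  assume "e > 0"
  \<comment> \<open>The summand \<open>1\<close> keeps the denominator positive when \<open>c = d\<close>.\<close>
  define \<epsilon> where "\<epsilon> = e / (d - c + 1)"
  have "\<epsilon> > 0" and \<epsilon>: "\<epsilon> * (d - c) \<le> e"
    using \<open>e > 0\<close> \<open>c \<le> d\<close> by (auto simp: \<epsilon>_def field_simps)
  from ge[OF \<open>\<epsilon> > 0\<close>] obtain \<delta> where "\<delta> > 0" and
    \<delta>: "\<And>p q. c \<le> p \<Longrightarrow> p \<le> q \<Longrightarrow> q \<le> d \<Longrightarrow> q - p < \<delta> \<Longrightarrow>
      F q - F p \<le> dist (\<gamma> p) (\<gamma> q) + \<epsilon> * (q - p)"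
    by blast
  obtain n :: nat where n: "(d - c) / \<delta> < real n"
    using reals_Archimedean2 by blast
  have "n > 0"
    using n \<open>\<delta> > 0\<close> \<open>c \<le> d\<close> by (cases n) (auto simp: field_simps)
  define u where "u i = c + (d - c) * real i / real n" for i
  have u: "mono_on {..n} u" "u 0 = c" "u n = d"
    using \<open>n > 0\<close> \<open>c \<le> d\<close>
    by (auto simp: u_def intro!: mono_onI divide_right_mono mult_left_mono)
  have step: "u (Suc i) - u i = (d - c) / n" for i
    by (simp add: u_def diff_divide_distrib[symmetric] right_diff_distrib[symmetric])
  let ?len = "\<Sum>i<n. dist (\<gamma> (u i)) (\<gamma> (u (Suc i)))"
  have "F d - F c = (\<Sum>i<n. F (u (Suc i)) - F (u i))"
    using u by (simp add: sum_lessThan_telescope[of "\<lambda>i. F (u i)"])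
  also have "\<dots> \<le> (\<Sum>i<n. dist (\<gamma> (u i)) (\<gamma> (u (Suc i))) + \<epsilon> * (u (Suc i) - u i))"
  proof (rule sum_mono)
    fix i assume "i \<in> {..<n}"
    moreover have "(d - c) / n < \<delta>"
      using n \<open>n > 0\<close> \<open>\<delta> > 0\<close> by (simp add: field_simps)
    ultimately show "F (u (Suc i)) - F (u i) \<le> dist (\<gamma> (u i)) (\<gamma> (u (Suc i))) + \<epsilon> * (u (Suc i) - u i)"
      using u step[of i] mono_onD[OF u(1), of 0 i] mono_onD[OF u(1), of i "Suc i"] mono_onD[OF u(1), of "Suc i" n]
      by (intro \<delta>) auto
  qed
  also have "\<dots> = ?len + \<epsilon> * (d - c)"
    by (simp add: sum.distrib sum_distrib_left[symmetric] sum_lessThan_telescope u)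
  finally have "ennreal (F d - F c) \<le> ennreal (?len + e)"
    using \<epsilon> by (intro ennreal_leI) simp
  also have "\<dots> = ennreal ?len + ennreal e"
    using \<open>e > 0\<close> by (simp add: sum_nonneg)
  also have "ennreal ?len \<le> curve_length \<gamma> c d"
    unfolding curve_length_def by (rule SUP_upper2[of "(n, u)"]) (use u in auto)
  finally show "ennreal (F d - F c) \<le> curve_length \<gamma> c d + ennreal e"
    by (simp add: add_right_mono)
qed

text \<open>
  The length is at most the integral because a chord is the integral of the velocity over its
  parameter interval. For the other inequality, on a compact \<open>{c..d}\<close> inside the open interval the
  velocity is uniformly continuous. On short steps it is then nearly constant, and both the chord and
  the integral of the speed are nearly speed times step. Letting \<open>c\<close> and \<open>d\<close> tend to the
  endpoints finishes the argument, because the indefinite integral of the speed is continuous up to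
  the endpoints even where the speed is unbounded.
\<close>

theorem curve_length_eq_integral_norm_derivative:
  fixes \<gamma> :: "real \<Rightarrow> 'a::euclidean_space"
  assumes "s < t"
    and cont: "continuous_on {s..t} \<gamma>"
    and der: "\<And>x. x \<in> {s<..<t} \<Longrightarrow> (\<gamma> has_vector_derivative \<gamma>' x) (at x)"
    and cont': "continuous_on {s<..<t} \<gamma>'"
    and int: "((\<lambda>x. norm (\<gamma>' x)) has_integral I) {s..t}"
  shows "curve_length \<gamma> s t = ennreal I"
proof -
  define F where "F x = integral {s..x} (\<lambda>x. norm (\<gamma>' x))" for x
  have Fs: "F s = 0" and Ft: "F t = I"
    using int by (auto simp: F_def integral_unique)
  have sub: "(\<lambda>x. norm (\<gamma>' x)) integrable_on {p..q}" if "s \<le> p" "q \<le> t" for p q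
    using int that integrable_on_subinterval[of _ "{s..t}" p q] by (auto dest: has_integral_integrable)
  have F_diff: "((\<lambda>x. norm (\<gamma>' x)) has_integral F q - F p) {p..q}" if "s \<le> p" "p \<le> q" "q \<le> t" for p q
    using sub[of p q] sub[of s q] that
      Henstock_Kurzweil_Integration.integral_combine[of s p q "\<lambda>x. norm (\<gamma>' x)"]
    by (simp add: F_def has_integral_iff algebra_simps)
  have ftc: "(\<gamma>' has_integral \<gamma> q - \<gamma> p) {p..q}" if "s \<le> p" "p \<le> q" "q \<le> t" for p q
    by (rule fundamental_theorem_of_calculus_interior)
      (use that in \<open>auto intro!: der intro: continuous_on_subset[OF cont]\<close>)
  have dist_le: "dist (\<gamma> p) (\<gamma> q) \<le> F q - F p" if "s \<le> p" "p \<le> q" "q \<le> t" for p q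
    using integral_norm_bound_integral[of \<gamma>' "{p..q}" "\<lambda>x. norm (\<gamma>' x)"] ftc[OF that] F_diff[OF that]
    by (simp add: has_integral_iff dist_norm norm_minus_commute)
  have upper: "curve_length \<gamma> s t \<le> ennreal I"
    using curve_length_le_of_dist_le[of s t \<gamma> F, OF dist_le] by (simp add: Fs Ft)
  have inner: "ennreal (F d - F c) \<le> curve_length \<gamma> s t" if cd: "s < c" "c \<le> d" "d < t" for c d
  proof -
    have "ennreal (F d - F c) \<le> curve_length \<gamma> c d"
    proof (rule curve_length_ge_of_dist_ge[OF \<open>c \<le> d\<close>])
      fix \<epsilon> :: real
      assume "\<epsilon> > 0"
      have "uniformly_continuous_on {c..d} \<gamma>'"
        by (rule compact_uniformly_continuous) (use cd in \<open>auto intro: continuous_on_subset[OF cont']\<close>)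
      then obtain \<delta> where "\<delta> > 0" and
        \<delta>: "\<And>x y. x \<in> {c..d} \<Longrightarrow> y \<in> {c..d} \<Longrightarrow> dist y x < \<delta> \<Longrightarrow> dist (\<gamma>' y) (\<gamma>' x) < \<epsilon> / 2"
        using \<open>\<epsilon> > 0\<close> unfolding uniformly_continuous_on_def by (metis half_gt_zero)
      have "F q - F p \<le> dist (\<gamma> p) (\<gamma> q) + \<epsilon> * (q - p)"
        if pq: "c \<le> p" "p \<le> q" "q \<le> d" "q - p < \<delta>" for p q
      proof -
        have pq': "s \<le> p" "p \<le> q" "q \<le> t"
          using pq cd by auto
        have near: "norm (\<gamma>' x - \<gamma>' p) \<le> \<epsilon> / 2" if "x \<in> {p..q}" for x
          using \<delta>[of p x] that pq by (auto simp: dist_norm)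
        have const: "((\<lambda>x. v) has_integral (q - p) *\<^sub>R v) {p..q}" for v :: "'b::euclidean_space"
          using has_integral_const_real[of v p q] pq by simp
        \<comment> \<open>Chord and integral of the speed are both compared with \<open>(q - p) *\<^sub>R \<gamma>' p\<close>, each
            within half of the permitted error.\<close>
        have "norm ((\<gamma> q - \<gamma> p) - (q - p) *\<^sub>R \<gamma>' p) \<le> (q - p) *\<^sub>R (\<epsilon> / 2)"
          using integral_norm_bound_integral[of "\<lambda>x. \<gamma>' x - \<gamma>' p" "{p..q}" "\<lambda>x. \<epsilon> / 2"] near
            has_integral_diff[OF ftc[OF pq'] const[of "\<gamma>' p"]] const[of "\<epsilon> / 2"]
            \<open>p \<le> q\<close>
          by (simp add: has_integral_iff)
        moreover have "F q - F p \<le> (q - p) *\<^sub>R (norm (\<gamma>' p) + \<epsilon> / 2)"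
        proof (rule has_integral_le[OF F_diff[OF pq'] const])
          fix x assume "x \<in> {p..q}"
          from near[OF this] show "norm (\<gamma>' x) \<le> norm (\<gamma>' p) + \<epsilon> / 2"
            using norm_triangle_ineq2[of "\<gamma>' x" "\<gamma>' p"] by linarith
        qed
        moreover have "norm ((q - p) *\<^sub>R \<gamma>' p) \<le> norm (\<gamma> q - \<gamma> p) + norm ((\<gamma> q - \<gamma> p) - (q - p) *\<^sub>R \<gamma>' p)"
          using norm_triangle_ineq4[of "\<gamma> q - \<gamma> p" "(\<gamma> q - \<gamma> p) - (q - p) *\<^sub>R \<gamma>' p"] by simp
        moreover have "norm ((q - p) *\<^sub>R \<gamma>' p) = (q - p) * norm (\<gamma>' p)"
          using pq by simp
        moreover have "\<epsilon> * (q - p) = (q - p) * (\<epsilon> / 2) + (q - p) * (\<epsilon> / 2)"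
          by simp
        ultimately show ?thesis
          unfolding dist_norm norm_minus_commute[of "\<gamma> p"] real_scaleR_def distrib_left by linarith
      qed
      with \<open>\<delta> > 0\<close> show "\<exists>\<delta>>0. \<forall>p q. c \<le> p \<longrightarrow> p \<le> q \<longrightarrow> q \<le> d \<longrightarrow> q - p < \<delta> \<longrightarrow>
          F q - F p \<le> dist (\<gamma> p) (\<gamma> q) + \<epsilon> * (q - p)"
        by blast
    qed
    also have "\<dots> \<le> curve_length \<gamma> s t"
      using cd by (intro curve_length_mono) auto
    finally show ?thesis .
  qed
  \<comment> \<open>The endpoints are reached one at a time, \<open>d\<close> first; the midpoint keeps \<open>c \<le> d\<close>.\<close>
  define m where "m = (s + t) / 2"
  have m: "s < m" "m < t"
    using \<open>s < t\<close> by (auto simp: m_def)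
  have F_cont: "continuous_on {s..t} F"
    unfolding F_def using int by (intro indefinite_integral_continuous_1) (rule has_integral_integrable)
  have F_lims: "(F \<longlongrightarrow> F s) (at_right s)" "(F \<longlongrightarrow> F t) (at_left t)"
    using F_cont \<open>s < t\<close> by (auto simp: continuous_on_Icc_at_rightD continuous_on_Icc_at_leftD)
  have upto: "ennreal (F t - F c) \<le> curve_length \<gamma> s t" if "s < c" "c \<le> m" for c
  proof (rule tendsto_upperbound)
    show "((\<lambda>d. ennreal (F d - F c)) \<longlongrightarrow> ennreal (F t - F c)) (at_left t)"
      by (intro tendsto_ennrealI tendsto_diff F_lims tendsto_const)
    show "\<forall>\<^sub>F d in at_left t. ennreal (F d - F c) \<le> curve_length \<gamma> s t"
      using eventually_at_left_real[OF m(2)] by eventually_elim (use that in \<open>auto intro: inner\<close>)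
  qed simp
  have "ennreal (F t - F s) \<le> curve_length \<gamma> s t"
  proof (rule tendsto_upperbound)
    show "((\<lambda>c. ennreal (F t - F c)) \<longlongrightarrow> ennreal (F t - F s)) (at_right s)"
      by (intro tendsto_ennrealI tendsto_diff F_lims tendsto_const)
    show "\<forall>\<^sub>F c in at_right s. ennreal (F t - F c) \<le> curve_length \<gamma> s t"
      using eventually_at_right_real[OF m(1)] by eventually_elim (auto intro: upto)
  qed simp
  with upper show ?thesis
    by (simp add: Fs Ft)
qed

section \<open>The length of the principal leaf\<close>

lemma leaf_cos_pos:
  assumes "\<alpha> > 0" and "\<theta> \<in> {- pi / \<alpha><..<pi / \<alpha>}"
  shows "cos (\<alpha> / 2 * \<theta>) > 0"
  using assms by (intro cos_gt_zero_pi) (auto simp: field_simps)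

lemma leaf_cos_nonneg:
  assumes "\<alpha> > 0" and "\<theta> \<in> {- pi / \<alpha>..pi / \<alpha>}"
  shows "cos (\<alpha> / 2 * \<theta>) \<ge> 0"
  using assms by (intro cos_ge_zero) (auto simp: field_simps)

lemma spiral_radius_has_derivative:
  assumes "\<alpha> > 0" and "\<theta> \<in> {- pi / \<alpha><..<pi / \<alpha>}"
  shows "(spiral_radius \<alpha> has_field_derivative
    - sin (\<alpha> / 2 * \<theta>) * cos (\<alpha> / 2 * \<theta>) powr (2 / \<alpha> - 1)) (at \<theta>)"
  unfolding spiral_radius_def[abs_def]
  by (rule derivative_eq_intros refl leaf_cos_pos[OF assms])+
    (use assms leaf_cos_pos[OF assms] in \<open>simp add: powr_diff\<close>)

lemma spiral_radius_eq_speed: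
  assumes "\<alpha> > 0" and "\<theta> \<in> {- pi / \<alpha><..<pi / \<alpha>}"
  shows "spiral_radius \<alpha> \<theta> = cos (\<alpha> / 2 * \<theta>) powr (2 / \<alpha> - 1) * cos (\<alpha> / 2 * \<theta>)"
  using leaf_cos_pos[OF assms] by (simp add: spiral_radius_def powr_diff)

text \<open>
  By the addition theorems the velocity is the scalar speed times a unit vector of direction
  \<open>\<alpha> / 2 * \<theta> + \<theta> + pi / 2\<close>, so its norm can be read off.
\<close>

lemma sinusoidal_spiral_has_vector_derivative:
  assumes "\<alpha> > 0" and "\<theta> \<in> {- pi / \<alpha><..<pi / \<alpha>}"
  shows "(sinusoidal_spiral \<alpha> has_vector_derivative
    cos (\<alpha> / 2 * \<theta>) powr (2 / \<alpha> - 1) *\<^sub>R (- sin (\<alpha> / 2 * \<theta> + \<theta>), cos (\<alpha> / 2 * \<theta> + \<theta>))) (at \<theta>)"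
proof -
  let ?w = "cos (\<alpha> / 2 * \<theta>) powr (2 / \<alpha> - 1)"
  note r = spiral_radius_has_derivative[OF assms]
  have "((\<lambda>\<theta>. spiral_radius \<alpha> \<theta> * cos \<theta>) has_field_derivative ?w * - sin (\<alpha> / 2 * \<theta> + \<theta>)) (at \<theta>)"
    by (rule derivative_eq_intros r refl)+
      (simp add: spiral_radius_eq_speed[OF assms] sin_add algebra_simps)
  moreover have "((\<lambda>\<theta>. spiral_radius \<alpha> \<theta> * sin \<theta>) has_field_derivative ?w * cos (\<alpha> / 2 * \<theta> + \<theta>)) (at \<theta>)"
    by (rule derivative_eq_intros r refl)+
      (simp add: spiral_radius_eq_speed[OF assms] cos_add algebra_simps)
  ultimately show ?thesis
    unfolding sinusoidal_spiral_def[abs_def] has_real_derivative_iff_has_vector_derivative scaleR_Pair real_scaleR_def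
    by (rule has_vector_derivative_Pair)
qed

lemma spiral_radius_image:
  assumes "\<alpha> > 0"
  shows "spiral_radius \<alpha> ` {0<..<pi / \<alpha>} = {0<..<1}"
proof -
  have "(\<lambda>\<theta>. \<alpha> / 2 * \<theta>) ` {0<..<pi / \<alpha>} = {0<..<pi / 2}"
    using assms mult_image_greaterThanLessThan[of "\<alpha> / 2" "pi / \<alpha>"] by simp
  moreover have "cos ` {0<..<pi / 2} = {0<..<1}"
  proof (intro equalityI subsetI)
    fix y :: real assume "y \<in> {0<..<1}"
    then show "y \<in> cos ` {0<..<pi / 2}"
      using arccos_lt_bounded[of y] arccos_less_arccos[of 0 y] by (intro image_eqI[of _ _ "arccos y"]) auto
  next
    fix y :: real assume "y \<in> cos ` {0<..<pi / 2}"
    then show "y \<in> {0<..<1}"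
      using cos_gt_zero cos_monotone_0_pi[of 0] by fastforce
  qed
  ultimately have "(\<lambda>\<theta>. cos (\<alpha> / 2 * \<theta>)) ` {0<..<pi / \<alpha>} = {0<..<1}"
    by (metis image_image)
  then have "spiral_radius \<alpha> ` {0<..<pi / \<alpha>} = (\<lambda>t. t powr (2 / \<alpha>)) ` {0<..<1}"
    using image_image[of "\<lambda>t. t powr (2 / \<alpha>)" "\<lambda>\<theta>. cos (\<alpha> / 2 * \<theta>)" "{0<..<pi / \<alpha>}"]
    by (simp only: spiral_radius_def[abs_def])
  also have "\<dots> = {0<..<1}"
    using assms by (intro powr_image_unit_interval) simp
  finally show ?thesis .
qed

text \<open>
  On \<open>0 < \<theta> < pi / \<alpha>\<close> the radius decreases from \<open>1\<close> to \<open>0\<close> and serves as the new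
  variable. There \<open>r powr \<alpha> = (cos (\<alpha> / 2 * \<theta>))\<^sup>2\<close>, so the sine in the derivative of the
  radius cancels the square root in the integrand of \<open>varpi\<close>.
\<close>

lemma spiral_speed_has_integral:
  assumes "\<alpha> > 0"
  shows "((\<lambda>\<theta>. cos (\<alpha> / 2 * \<theta>) powr (2 / \<alpha> - 1)) has_integral varpi \<alpha>) {- pi / \<alpha>..pi / \<alpha>}"
proof -
  let ?f = "\<lambda>r. 1 / sqrt (1 - r powr \<alpha>)"
  let ?r' = "\<lambda>\<theta>. - sin (\<alpha> / 2 * \<theta>) * cos (\<alpha> / 2 * \<theta>) powr (2 / \<alpha> - 1)"
  have dom: "\<theta> \<in> {- pi / \<alpha><..<pi / \<alpha>}" if "\<theta> \<in> {0<..<pi / \<alpha>}" for \<theta>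
    using that assms by (auto intro: less_trans[of _ 0])
  have angle: "0 < \<alpha> / 2 * \<theta>" "\<alpha> / 2 * \<theta> < pi" if "\<theta> \<in> {0<..<pi / \<alpha>}" for \<theta>
  proof -
    show "0 < \<alpha> / 2 * \<theta>"
      using that assms by simp
    have "\<alpha> * \<theta> < pi"
      using that assms by (simp add: pos_less_divide_eq mult.commute)
    then show "\<alpha> / 2 * \<theta> < pi"
      using pi_gt_zero by linarith
  qed
  have "(?f has_integral varpi \<alpha> / 2) (spiral_radius \<alpha> ` {0<..<pi / \<alpha>})"
    using has_integral_varpi[OF assms] by (simp add: spiral_radius_image[OF assms] has_integral_Icc_iff_Ioo)
  moreover have "((\<lambda>\<theta>. \<bar>?r' \<theta>\<bar> * ?f (spiral_radius \<alpha> \<theta>)) has_integral varpi \<alpha> / 2) {0<..<pi / \<alpha>}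
      \<longleftrightarrow> (?f has_integral varpi \<alpha> / 2) (spiral_radius \<alpha> ` {0<..<pi / \<alpha>})"
  proof (rule has_integral_nonneg_substitution_iff)
    show "(spiral_radius \<alpha> has_field_derivative ?r' \<theta>) (at \<theta>)" if "\<theta> \<in> {0<..<pi / \<alpha>}" for \<theta>
      by (rule spiral_radius_has_derivative[OF assms dom[OF that]])
    show "inj_on (spiral_radius \<alpha>) {0<..<pi / \<alpha>}"
    proof (rule inj_onI)
      fix x y assume xy: "x \<in> {0<..<pi / \<alpha>}" "y \<in> {0<..<pi / \<alpha>}" "spiral_radius \<alpha> x = spiral_radius \<alpha> y"
      have "cos (\<alpha> / 2 * x) = cos (\<alpha> / 2 * y)"
      proof (rule inj_onD[OF inj_on_powr_base])
        show "cos (\<alpha> / 2 * x) powr (2 / \<alpha>) = cos (\<alpha> / 2 * y) powr (2 / \<alpha>)"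
          using xy(3) by (simp only: spiral_radius_def)
        show "cos (\<alpha> / 2 * x) \<in> {0..}" "cos (\<alpha> / 2 * y) \<in> {0..}"
          using leaf_cos_pos[OF assms dom[OF xy(1)]] leaf_cos_pos[OF assms dom[OF xy(2)]] by simp_all
      qed (use assms in simp)
      then have "\<alpha> / 2 * x = \<alpha> / 2 * y"
        by (rule cos_inj_pi[rotated 4]) (use angle[OF xy(1)] angle[OF xy(2)] in simp_all)
      then show "x = y"
        using assms by simp
    qed
    show "0 \<le> ?f r" if "r \<in> spiral_radius \<alpha> ` {0<..<pi / \<alpha>}" for r
      using that powr_less_mono2[of \<alpha> r 1] assms unfolding spiral_radius_image[OF assms] by auto
  qed auto
  ultimately have "((\<lambda>\<theta>. \<bar>?r' \<theta>\<bar> * ?f (spiral_radius \<alpha> \<theta>)) has_integral varpi \<alpha> / 2) {0<..<pi / \<alpha>}"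
    by blast
  then have "((\<lambda>\<theta>. cos (\<alpha> / 2 * \<theta>) powr (2 / \<alpha> - 1)) has_integral varpi \<alpha> / 2) {0<..<pi / \<alpha>}"
  proof (rule has_integral_eq[rotated])
    fix \<theta> assume \<theta>: "\<theta> \<in> {0<..<pi / \<alpha>}"
    have c: "cos (\<alpha> / 2 * \<theta>) > 0"
      by (rule leaf_cos_pos[OF assms dom[OF \<theta>]])
    have s: "sin (\<alpha> / 2 * \<theta>) > 0"
      using angle[OF \<theta>] by (intro sin_gt_zero)
    have "spiral_radius \<alpha> \<theta> powr \<alpha> = (cos (\<alpha> / 2 * \<theta>))\<^sup>2"
      using c assms by (simp add: spiral_radius_def powr_powr)
    then have "sqrt (1 - spiral_radius \<alpha> \<theta> powr \<alpha>) = sin (\<alpha> / 2 * \<theta>)"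
      using s by (simp add: sin_squared_eq[symmetric])
    then show "\<bar>?r' \<theta>\<bar> * ?f (spiral_radius \<alpha> \<theta>) = cos (\<alpha> / 2 * \<theta>) powr (2 / \<alpha> - 1)"
      using s by (simp add: abs_mult)
  qed
  then have "((\<lambda>\<theta>. cos (\<alpha> / 2 * \<theta>) powr (2 / \<alpha> - 1)) has_integral 2 * (varpi \<alpha> / 2)) {- (pi / \<alpha>)..pi / \<alpha>}"
    using assms by (intro has_integral_even) (auto simp: has_integral_Icc_iff_Ioo)
  then show ?thesis
    by simp
qed

lemma curve_length_sinusoidal_spiral:
  assumes "\<alpha> > 0"
  shows "curve_length (sinusoidal_spiral \<alpha>) (- pi / \<alpha>) (pi / \<alpha>) = ennreal (varpi \<alpha>)"
proof (rule curve_length_eq_integral_norm_derivative)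
  let ?\<gamma>' = "\<lambda>\<theta>. cos (\<alpha> / 2 * \<theta>) powr (2 / \<alpha> - 1) *\<^sub>R (- sin (\<alpha> / 2 * \<theta> + \<theta>), cos (\<alpha> / 2 * \<theta> + \<theta>))"
  show "- pi / \<alpha> < pi / \<alpha>"
    using assms by (simp add: divide_strict_right_mono)
  show "continuous_on {- pi / \<alpha>..pi / \<alpha>} (sinusoidal_spiral \<alpha>)"
    unfolding sinusoidal_spiral_def[abs_def] spiral_radius_def
    by (intro continuous_intros continuous_on_powr') (use assms leaf_cos_nonneg in auto)
  show "(sinusoidal_spiral \<alpha> has_vector_derivative ?\<gamma>' \<theta>) (at \<theta>)"
    if "\<theta> \<in> {- pi / \<alpha><..<pi / \<alpha>}" for \<theta>
    by (rule sinusoidal_spiral_has_vector_derivative[OF assms that])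
  show "continuous_on {- pi / \<alpha><..<pi / \<alpha>} ?\<gamma>'"
    by (intro continuous_intros ballI) (metis assms leaf_cos_pos less_irrefl)
  have "norm (?\<gamma>' \<theta>) = cos (\<alpha> / 2 * \<theta>) powr (2 / \<alpha> - 1)" for \<theta>
    by (simp add: norm_Pair del: scaleR_Pair)
  then show "((\<lambda>\<theta>. norm (?\<gamma>' \<theta>)) has_integral varpi \<alpha>) {- pi / \<alpha>..pi / \<alpha>}"
    using spiral_speed_has_integral[OF assms] by simp
qed

theorem corollary4:
  fixes \<alpha> a b :: real
  assumes "\<alpha> > 0" and "a > 0" and "b > 0"
  shows "measure lebesgue (superellipse_region \<alpha> a b) = 2 powr (1 - 2 / \<alpha>) * varpi \<alpha> * a * b
       \<and> curve_length (sinusoidal_spiral \<alpha>) (- pi / \<alpha>) (pi / \<alpha>) = ennreal (varpi \<alpha>)"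
  using measure_superellipse_region[OF assms] curve_length_sinusoidal_spiral[OF assms(1)] by simp

end
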